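(* Let $X$ be a Euclidean space, let $I$ be a nonempty finite set, let $\mathcal{F}=\{f_i\}_{i\in I}$ be a compatible system of proper convex functions from $X$ to $]-\infty,+\infty]$, and let $f:=\min_{i\in I}f_i$. Assume that for each $i\in I$, $\operatorname{int}D_{f_i}\neq\varnothing$ and $f_i$ is differentiable on $\operatorname{int}D_{f_i}$, and that the following hold: (a) $D_f=\bigcup_{i\in I}D_{f_i}$ is convex and at least $2$-dimensional. (b) $\{D_{f_i}\}_{i\in I}$ is a compatible system of sets. (c) There exists a finite subset $E$ of $X$ such that for every $x\in(\operatorname{int}D_f)\smallsetminus E$ and all $i,j$ with $\{i,j\}\subseteq I(x)$, the limits $$\lim_{z\to x,\; z\in\operatorname{int}D_{f_i}}\nabla f_i(z)\quad\text{and}\quad\lim_{z\to x,\; z\in\operatorname{int}D_{f_j}}\nabla f_j(z)$$ exist and are equal. Then $f$ is convex; moreover, $f$ is continuously differentiable on $(\operatorname{int}D_f)\smallsetminus E$.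
   Context: $X$ is a (finite-dimensional) Euclidean space with inner product $\langle\cdot,\cdot\rangle$ and norm $\|\cdot\|$. For $g\colon X\to\,]-\infty,+\infty]$, the domain is $D_g:=\{x\in X: g(x)<+\infty\}$, and $g$ is proper if $D_g\neq\varnothing$. $g$ is differentiable at $x\in\operatorname{int}D_g$ if there is $\nabla g(x)\in X$ with $g(y)-g(x)-\langle\nabla g(x),y-x\rangle=o(\|y-x\|)$. $\operatorname{cl}$, $\operatorname{int}$ and $\operatorname{ri}$ denote closure, interior and relative interior (interior relative to the affine hull). The dimension of a nonempty set $A\subseteq X$ is $\dim A:=\dim(\operatorname{aff}A-\operatorname{aff}A)$. Active index set: $I(x):=\{i\in I: x\in D_{f_i}\}$. Compatible system of functions: $\mathcal{F}=\{f_i\}_{i\in I}$ is compatible if each restriction $f_i|_{D_{f_i}}$ is continuous and, for all $i\neq j$ in $I$, $f_i$ and $f_j$ coincide on $D_{f_i}\cap D_{f_j}$. Compatible system of sets: a finite system $\{A_i\}_{i\in I}$ of convex subsets of $X$, with $A:=\bigcup_{i\in I}A_i$, is compatible if for all $i\neq j$ in $I$, $\operatorname{cl}A_i\cap\operatorname{cl}A_j\cap\operatorname{ri}A=A_i\cap A_j\cap\operatorname{ri}A$. *)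

theory Defs
  imports "HOL-Analysis.Analysis"
begin

text \<open>
  Functions from \<open>X\<close> to \<open>]-\<infinity>, +\<infinity>]\<close> are represented as functions into \<^typ>\<open>ereal\<close>;
  the exclusion of the value \<open>-\<infinity>\<close> is part of \<open>proper_fun\<close>.
\<close>

definition dom_of :: "('a \<Rightarrow> ereal) \<Rightarrow> 'a set"
  where "dom_of g = {x. g x < \<infinity>}"

definition proper_fun :: "('a \<Rightarrow> ereal) \<Rightarrow> bool"
  where "proper_fun g \<longleftrightarrow> (\<forall>x. g x \<noteq> -\<infinity>) \<and> dom_of g \<noteq> {}"

text \<open>
  The open range of \<open>t\<close> avoids the products \<open>0 * \<infinity>\<close>. The sum is the intended one because
  this is only used for functions that do not take the value \<open>-\<infinity>\<close>.
\<close>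

definition convex_fun :: "('a::real_vector \<Rightarrow> ereal) \<Rightarrow> bool"
  where "convex_fun g \<longleftrightarrow>
    (\<forall>x y. \<forall>t\<in>{0<..<1::real}.
       g ((1 - t) *\<^sub>R x + t *\<^sub>R y) \<le> ereal (1 - t) * g x + ereal t * g y)"

text \<open>
  \<open>real_of_ereal\<close> sends \<open>\<infinity>\<close> to \<open>0\<close>, but since \<open>x\<close> is interior to the domain, only the finite
  values of \<open>g\<close> near \<open>x\<close> matter.
\<close>

definition has_gradient :: "('a::real_inner \<Rightarrow> ereal) \<Rightarrow> 'a \<Rightarrow> 'a \<Rightarrow> bool"
  where "has_gradient g x v \<longleftrightarrow>
    x \<in> interior (dom_of g) \<and> GDERIV (\<lambda>y. real_of_ereal (g y)) x :> v"

definition gradient :: "('a::real_inner \<Rightarrow> ereal) \<Rightarrow> 'a \<Rightarrow> 'a"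
  where "gradient g x = (THE v. has_gradient g x v)"

lemma has_gradient_imp_gradient_eq:
  assumes "has_gradient g x v"
  shows "gradient g x = v"
proof -
  have "w = v" if "has_gradient g x w" for w
  proof -
    have "(\<lambda>h. inner h w) = (\<lambda>h. inner h v)"
    proof (rule has_derivative_unique)
      show "((\<lambda>y. real_of_ereal (g y)) has_derivative (\<lambda>h. inner h w)) (at x)"
        using that by (simp only: has_gradient_def gderiv_def)
      show "((\<lambda>y. real_of_ereal (g y)) has_derivative (\<lambda>h. inner h v)) (at x)"
        using assms by (simp only: has_gradient_def gderiv_def)
    qed
    then have "\<forall>h. inner h w = inner h v"
      by (auto dest: fun_cong)
    then show "w = v"
      by (simp only: vector_eq_ldot)
  qed
  with assms show ?thesis
    unfolding gradient_def by (rule the_equality)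
qed

definition differentiable_fun_on :: "('a::real_inner \<Rightarrow> ereal) \<Rightarrow> 'a set \<Rightarrow> bool"
  where "differentiable_fun_on g U \<longleftrightarrow> (\<forall>x\<in>U. \<exists>v. has_gradient g x v)"

definition continuously_differentiable_fun_on :: "('a::real_inner \<Rightarrow> ereal) \<Rightarrow> 'a set \<Rightarrow> bool"
  where "continuously_differentiable_fun_on g U \<longleftrightarrow>
    differentiable_fun_on g U \<and> continuous_on U (gradient g)"

definition active :: "'i set \<Rightarrow> ('i \<Rightarrow> 'a \<Rightarrow> ereal) \<Rightarrow> 'a \<Rightarrow> 'i set"
  where "active I f x = {i \<in> I. x \<in> dom_of (f i)}"

definition compatible_funs :: "'i set \<Rightarrow> ('i \<Rightarrow> 'a::topological_space \<Rightarrow> ereal) \<Rightarrow> bool"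
  where "compatible_funs I f \<longleftrightarrow>
    (\<forall>i\<in>I. continuous_on (dom_of (f i)) (f i)) \<and>
    (\<forall>i\<in>I. \<forall>j\<in>I. i \<noteq> j \<longrightarrow> (\<forall>x \<in> dom_of (f i) \<inter> dom_of (f j). f i x = f j x))"

definition compatible_sets :: "'i set \<Rightarrow> ('i \<Rightarrow> 'a::euclidean_space set) \<Rightarrow> bool"
  where "compatible_sets I A \<longleftrightarrow>
    finite I \<and> (\<forall>i\<in>I. convex (A i)) \<and>
    (\<forall>i\<in>I. \<forall>j\<in>I. i \<noteq> j \<longrightarrow>
       closure (A i) \<inter> closure (A j) \<inter> rel_interior (\<Union>k\<in>I. A k) =
       A i \<inter> A j \<inter> rel_interior (\<Union>k\<in>I. A k))"

definition min_fun :: "'i set \<Rightarrow> ('i \<Rightarrow> 'a \<Rightarrow> ereal) \<Rightarrow> 'a \<Rightarrow> ereal"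
  where "min_fun I f x = Min ((\<lambda>i. f i x) ` I)"

lemma dom_of_min_fun:
  assumes "finite I" "I \<noteq> {}"
  shows "dom_of (min_fun I f) = (\<Union>i\<in>I. dom_of (f i))"
proof -
  have "min_fun I f x < \<infinity> \<longleftrightarrow> (\<exists>i\<in>I. f i x < \<infinity>)" for x
    using assms unfolding min_fun_def by (subst Min_less_iff) blast+
  then show ?thesis
    unfolding dom_of_def by blast
qed

end

theory Submission
  imports Defs
begin

text \<open>
  By compatibility each \<open>D\<^sub>i = dom f\<^sub>i\<close> is closed relative to \<open>int D\<close>, so \<open>f\<close> is glued from finitely
  many continuous pieces there. Away from \<open>E\<close> the mean value theorem turns the common limit of the
  gradients into the derivative of \<open>f\<close>. Along a segment in \<open>int D\<close> that avoids \<open>E\<close>, the directional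
  derivative increases on every piece, hence increases, so \<open>f\<close> is convex on the segment. Any other
  segment in \<open>int D\<close> becomes one avoiding \<open>E\<close> after an arbitrarily small shift orthogonal to it, which
  is possible in dimension at least \<open>2\<close>. Finally, convexity passes from \<open>int D\<close> to \<open>D\<close> by radial limits:
  \<open>f(z)\<close> is the limit of \<open>f\<close> at \<open>z\<close> along a ray into \<open>int D\<^sub>k\<close>, where \<open>z \<in> D\<^sub>k\<close>.
\<close>

section \<open>Limits and derivatives within finite unions of sets\<close>

lemma Lim_within_UN:
  assumes "finite I" and "\<And>i. i \<in> I \<Longrightarrow> (f \<longlongrightarrow> l) (at x within C i)"
  shows "(f \<longlongrightarrow> l) (at x within (\<Union>i\<in>I. C i))"
  using assms by (induction I rule: finite_induct) (auto intro: Lim_Un)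

lemma has_derivative_within_UN:
  assumes "finite I" and "I \<noteq> {}" and "\<And>i. i \<in> I \<Longrightarrow> (g has_derivative g') (at x within C i)"
  shows "(g has_derivative g') (at x within (\<Union>i\<in>I. C i))"
  using assms by (auto simp: has_derivative_within intro: Lim_within_UN)

text \<open>The filter \<open>at x within S\<close> is \<open>bot\<close> here, so the derivative
  condition is vacuous. This handles the pieces that stay away from \<open>x\<close>.\<close>

lemma has_derivative_within_not_closure:
  assumes "x \<notin> closure S" and "bounded_linear g'"
  shows "(g has_derivative g') (at x within S)"
  using assms by (auto simp: has_derivative_within dest: not_in_closure_trivial_limitI)

section \<open>Approaching a point of a convex set along a ray from its interior\<close>

lemma eventually_radial_interior:
  fixes S :: "'a::euclidean_space set"
  assumes "convex S" and "c \<in> interior S" and "x \<in> S"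
  shows "\<forall>\<^sub>F s in at_right 0. x + s *\<^sub>R (c - x) \<in> interior S"
proof -
  have "x + s *\<^sub>R (c - x) \<in> interior S" if "0 < s" "s < 1" for s :: real
    using mem_interior_closure_convex_shrink[of S c x s] assms that closure_subset[of S]
    by (auto simp: algebra_simps)
  then show ?thesis
    unfolding eventually_at_right_field by (intro exI[of _ 1]) auto
qed

lemma add_scaleR_diff_in_closed_segment:
  fixes x y :: "'a::real_vector"
  assumes "0 \<le> s" and "s \<le> 1"
  shows "x + s *\<^sub>R (y - x) \<in> closed_segment x y"
  using assms unfolding closed_segment_def by (auto intro!: exI[of _ s] simp: algebra_simps)

lemma tendsto_radial:
  fixes x c :: "'a::real_normed_vector"
  shows "((\<lambda>s. x + s *\<^sub>R (c - x)) \<longlongrightarrow> x) (at_right 0)"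
proof -
  have "((\<lambda>s. x + s *\<^sub>R (c - x)) \<longlongrightarrow> x + 0 *\<^sub>R (c - x)) (at_right 0)"
    by (rule tendsto_add[OF tendsto_const tendsto_scaleR[OF tendsto_ident_at tendsto_const]])
  then show ?thesis
    by simp
qed

text \<open>The ray stays in \<open>S\<close> for small \<open>s\<close>, so continuity relative to
  \<open>S\<close> suffices even when \<open>x\<close> is a boundary point.\<close>

lemma tendsto_radial_continuous_on:
  fixes S :: "'a::euclidean_space set"
  assumes "convex S" and "c \<in> interior S" and "x \<in> S" and "continuous_on S g"
  shows "((\<lambda>s. g (x + s *\<^sub>R (c - x))) \<longlongrightarrow> g x) (at_right 0)"
proof (rule continuous_on_tendsto_compose[OF assms(4) tendsto_radial assms(3)])
  show "\<forall>\<^sub>F s in at_right 0. x + s *\<^sub>R (c - x) \<in> S"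
    using eventually_radial_interior[OF assms(1-3)]
    by eventually_elim (use interior_subset in blast)
qed

text \<open>The interior is dense in a convex set with nonempty interior, and an open set has no
  isolated points. This makes limits of gradients taken from the interior unique.\<close>

lemma at_within_interior_neq_bot:
  fixes S :: "'a::euclidean_space set"
  assumes "convex S" and "interior S \<noteq> {}" and "x \<in> S"
  shows "at x within interior S \<noteq> bot"
proof -
  have "x \<in> closure (interior S)"
    using convex_closure_interior[OF assms(1,2)] closure_subset assms(3) by blast
  then have "x islimpt interior S"
    using interior_limit_point[of x "interior S"] by (auto simp: closure_def)
  then show ?thesis
    by (simp add: trivial_limit_within)
qed

section \<open>Derivatives of convex functions and limits of gradients\<close>

text \<open>The difference quotients from \<open>p\<close> towards \<open>q\<close> are bounded by
  the increment over the whole segment, and they converge to the directional derivative. Convexity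
  is asked only on \<open>S\<close>, and \<open>p\<close> may lie on the boundary of
  \<open>S\<close>.\<close>

lemma has_derivative_le_increment:
  fixes g :: "'a::real_normed_vector \<Rightarrow> real"
  assumes "(g has_derivative g') (at p)" and "convex_on S g" and "p \<in> S" and "q \<in> S"
  shows "g' (q - p) \<le> g q - g p"
proof -
  have "((\<lambda>t. g (p + t *\<^sub>R (q - p))) has_derivative (\<lambda>t. g' (t *\<^sub>R (q - p)))) (at (0::real))"
  proof (rule has_derivative_compose[of "\<lambda>t. p + t *\<^sub>R (q - p)"])
    show "((\<lambda>t. p + t *\<^sub>R (q - p)) has_derivative (\<lambda>t. t *\<^sub>R (q - p))) (at (0::real))"
      by (auto intro!: derivative_eq_intros)
  qed (use assms(1) in simp)
  moreover have "g' (t *\<^sub>R (q - p)) = t * g' (q - p)" for t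
    using linear_scale[OF has_derivative_linear[OF assms(1)]] by simp
  ultimately have "((\<lambda>t. g (p + t *\<^sub>R (q - p))) has_real_derivative g' (q - p)) (at 0)"
    by (simp add: has_field_derivative_def mult_commute_abs)
  then have "((\<lambda>t. (g (p + t *\<^sub>R (q - p)) - g p) / t) \<longlongrightarrow> g' (q - p)) (at_right 0)"
    unfolding has_field_derivative_iff by (auto intro: tendsto_within_subset)
  moreover have "\<forall>\<^sub>F t in at_right 0. (g (p + t *\<^sub>R (q - p)) - g p) / t \<le> g q - g p"
  proof -
    have "(g (p + t *\<^sub>R (q - p)) - g p) / t \<le> g q - g p" if "0 < t" "t < 1" for t :: real
    proof -
      have "g ((1 - t) *\<^sub>R p + t *\<^sub>R q) \<le> (1 - t) * g p + t * g q"
        using that by (intro convex_onD[OF assms(2)] assms) auto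
      then have "g (p + t *\<^sub>R (q - p)) - g p \<le> (g q - g p) * t"
        by (simp add: algebra_simps)
      then show ?thesis
        using that by (simp add: divide_le_eq)
    qed
    then show ?thesis
      unfolding eventually_at_right_field by (intro exI[of _ 1]) auto
  qed
  ultimately show ?thesis
    by (rule tendsto_upperbound) simp
qed

text \<open>By the mean value theorem, the error of the linear approximation by \<open>L\<close> is
  controlled by \<open>G - L\<close> at an intermediate point, which is an interior point of
  \<open>S\<close> close to \<open>x\<close>.\<close>

lemma has_derivative_within_gradient_limit:
  fixes g :: "'a::euclidean_space \<Rightarrow> real"
  assumes "convex S" and "interior S \<noteq> {}" and cont: "continuous_on S g" and "x \<in> S"
    and deriv: "\<And>z. z \<in> interior S \<Longrightarrow> GDERIV g z :> G z"
    and lim: "(G \<longlongrightarrow> L) (at x within interior S)"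
  shows "(g has_derivative (\<lambda>h. inner h L)) (at x within S)"
  unfolding has_derivative_within_alt
proof (intro conjI allI impI)
  show "bounded_linear (\<lambda>h. inner h L)"
    by (rule bounded_linear_inner_left)
next
  fix e :: real
  assume "0 < e"
  then obtain d where "d > 0" and d: "\<And>z. z \<in> interior S \<Longrightarrow> z \<noteq> x \<Longrightarrow> dist z x < d \<Longrightarrow> dist (G z) L < e"
    using lim unfolding tendsto_iff eventually_at by metis
  \<comment> \<open>First the estimate for interior \<open>y\<close>: then the whole segment except
    possibly \<open>x\<close> is interior, so \<open>g\<close> is differentiable along it.\<close>
  have *: "norm (g y - g x - inner (y - x) L) \<le> e * norm (y - x)"
    if y: "y \<in> interior S" "norm (y - x) < d" for y
  proof (cases "y = x")
    case False
    have seg: "x + s *\<^sub>R (y - x) \<in> interior S" if "0 < s" "s \<le> 1" for s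
      using mem_interior_closure_convex_shrink[of S y x s] assms that y closure_subset[of S]
      by (auto simp: algebra_simps)
    \<comment> \<open>Subtracting the linear part makes \<open>h 1 - h 0\<close> exactly the
      approximation error.\<close>
    define h where "h s = g (x + s *\<^sub>R (y - x)) - s * inner (y - x) L" for s
    have "continuous_on {0..1} h"
      unfolding h_def
    proof (intro continuous_intros continuous_on_compose2[OF cont])
      have "x + s *\<^sub>R (y - x) \<in> S" if "0 \<le> s" "s \<le> 1" for s
        using seg[of s] that \<open>x \<in> S\<close> interior_subset[of S] by (cases "s = 0") auto
      then show "(\<lambda>s. x + s *\<^sub>R (y - x)) ` {0..1} \<subseteq> S"
        by auto
    qed
    moreover have "(h has_derivative (\<lambda>t. inner (t *\<^sub>R (y - x)) (G (x + s *\<^sub>R (y - x))) - t * inner (y - x) L)) (at s)"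
      if "0 < s" "s < 1" for s
    proof -
      have "(g has_derivative (\<lambda>h. inner h (G (x + s *\<^sub>R (y - x))))) (at (x + s *\<^sub>R (y - x)))"
        using deriv[OF seg, of s] that by (simp add: gderiv_def)
      moreover have "((\<lambda>s. x + s *\<^sub>R (y - x)) has_derivative (\<lambda>s. s *\<^sub>R (y - x))) (at s)"
        by (auto intro!: derivative_eq_intros)
      ultimately have "((\<lambda>s. g (x + s *\<^sub>R (y - x))) has_derivative
          (\<lambda>t. inner (t *\<^sub>R (y - x)) (G (x + s *\<^sub>R (y - x))))) (at s)"
        by (rule has_derivative_compose[rotated])
      moreover have "((\<lambda>s. s * inner (y - x) L) has_derivative (\<lambda>t. t * inner (y - x) L)) (at s)"
        by (auto intro!: derivative_eq_intros)
      ultimately show ?thesis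
        unfolding h_def by (rule has_derivative_diff)
    qed
    ultimately obtain s where s: "0 < s" "s < 1"
      and "h 1 - h 0 = inner ((1 - 0) *\<^sub>R (y - x)) (G (x + s *\<^sub>R (y - x))) - (1 - 0) * inner (y - x) L"
      using mvt[of 0 1 h "\<lambda>s t. inner (t *\<^sub>R (y - x)) (G (x + s *\<^sub>R (y - x))) - t * inner (y - x) L"] by auto
    then have "g y - g x - inner (y - x) L = inner (y - x) (G (x + s *\<^sub>R (y - x)) - L)"
      by (simp add: h_def inner_diff_right)
    also have "norm \<dots> \<le> norm (y - x) * norm (G (x + s *\<^sub>R (y - x)) - L)"
      by (simp add: Cauchy_Schwarz_ineq2)
    also have "\<dots> \<le> norm (y - x) * e"
    proof -
      have "s * norm (y - x) \<le> norm (y - x)"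
        using s by (simp add: mult_left_le_one_le)
      then have "dist (x + s *\<^sub>R (y - x)) x < d"
        using y s by (simp add: dist_norm)
      then have "dist (G (x + s *\<^sub>R (y - x))) L < e"
        using s False seg[of s] by (intro d) auto
      then show ?thesis
        by (intro mult_left_mono) (auto simp: dist_norm)
    qed
    finally show ?thesis
      by (simp add: mult.commute)
  qed simp
  show "\<exists>d>0. \<forall>y\<in>S. norm (y - x) < d \<longrightarrow> norm (g y - g x - inner (y - x) L) \<le> e * norm (y - x)"
  proof (intro exI[of _ d] conjI ballI impI)
    fix y
    assume y: "y \<in> S" "norm (y - x) < d"
    \<comment> \<open>A boundary point \<open>y\<close> is approached radially from the interior;
      both sides of the estimate are continuous along the ray, so it survives in the limit.\<close>
    obtain c where c: "c \<in> interior S"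
      using assms(2) by auto
    let ?y = "\<lambda>s. y + s *\<^sub>R (c - y)"
    have "((\<lambda>s. e * norm (?y s - x) - norm (g (?y s) - g x - inner (?y s - x) L))
        \<longlongrightarrow> e * norm (y - x) - norm (g y - g x - inner (y - x) L)) (at_right 0)"
      by (intro tendsto_intros tendsto_radial tendsto_radial_continuous_on[OF assms(1) c y(1) cont])
    moreover have "((\<lambda>s. norm (?y s - x)) \<longlongrightarrow> norm (y - x)) (at_right 0)"
      by (intro tendsto_intros tendsto_radial)
    then have "\<forall>\<^sub>F s in at_right 0. norm (?y s - x) < d"
      using y by (intro order_tendstoD)
    then have "\<forall>\<^sub>F s in at_right 0. 0 \<le> e * norm (?y s - x) - norm (g (?y s) - g x - inner (?y s - x) L)"
      using eventually_radial_interior[OF assms(1) c y(1)]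
      by eventually_elim (use * in auto)
    ultimately have "0 \<le> e * norm (y - x) - norm (g y - g x - inner (y - x) L)"
      by (rule tendsto_lowerbound) simp
    then show "norm (g y - g x - inner (y - x) L) \<le> e * norm (y - x)"
      by simp
  qed fact
qed

text \<open>Bisection: on a short interval around \<open>u\<close>, both endpoints are compared with
  \<open>u\<close>, and adjacent intervals chain by transitivity.\<close>

lemma locally_mono_imp_le:
  fixes h :: "real \<Rightarrow> 'b::order"
  assumes "a \<le> b"
    and "\<And>u. a \<le> u \<Longrightarrow> u \<le> b \<Longrightarrow>
      \<exists>d>0. \<forall>v\<in>{a..b}. \<bar>v - u\<bar> < d \<longrightarrow> (v \<le> u \<longrightarrow> h v \<le> h u) \<and> (u \<le> v \<longrightarrow> h u \<le> h v)"
  shows "h a \<le> h b"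
proof -
  have "a \<le> a \<and> b \<le> b \<longrightarrow> h a \<le> h b"
    using \<open>a \<le> b\<close>
  proof (induction rule: Bolzano[of a b "\<lambda>u v. a \<le> u \<and> v \<le> b \<longrightarrow> h u \<le> h v"])
    case (trans u v w)
    then show ?case
      by (meson order_trans)
  next
    case (local u)
    then obtain d where "d > 0" and
      d: "\<And>v. v \<in> {a..b} \<Longrightarrow> \<bar>v - u\<bar> < d \<Longrightarrow> (v \<le> u \<longrightarrow> h v \<le> h u) \<and> (u \<le> v \<longrightarrow> h u \<le> h v)"
      using assms(2)[of u] by blast
    show ?case
    proof (intro exI[of _ d] conjI allI impI)
      fix v w
      assume "v \<le> u \<and> u \<le> w \<and> w - v < d" "a \<le> v \<and> w \<le> b"
      then have "h v \<le> h u" "h u \<le> h w"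
        using d[of v] d[of w] local by auto
      then show "h v \<le> h w"
        by (rule order_trans)
    qed fact
  qed
  then show ?thesis
    by simp
qed

text \<open>The real-valued core of the problem: \<open>C i\<close> stands for the domain of the
  i-th function and \<open>g\<close> for the glued function. \<open>G\<close> is tied to
  \<open>g\<close> only on the interiors of the pieces, since differentiability where pieces meet is
  yet to be shown. \<open>closed_C\<close> is what compatibility of the sets provides.\<close>

locale glued_convex =
  fixes I :: "'i set" and C :: "'i \<Rightarrow> 'a::euclidean_space set" and g :: "'a \<Rightarrow> real"
    and G :: "'a \<Rightarrow> 'a" and E :: "'a set"
  assumes finite_I: "finite I"
    and convex_C: "i \<in> I \<Longrightarrow> convex (C i)"
    and interior_C: "i \<in> I \<Longrightarrow> interior (C i) \<noteq> {}"
    and cont_C: "i \<in> I \<Longrightarrow> continuous_on (C i) g"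
    and convex_on_C: "i \<in> I \<Longrightarrow> convex_on (C i) g"
    and deriv_C: "i \<in> I \<Longrightarrow> z \<in> interior (C i) \<Longrightarrow> GDERIV g z :> G z"
    and convex_D: "convex (\<Union>i\<in>I. C i)"
    and closed_C: "i \<in> I \<Longrightarrow> x \<in> interior (\<Union>i\<in>I. C i) \<Longrightarrow> x \<in> closure (C i) \<Longrightarrow> x \<in> C i"
    and finite_E: "finite E"
    and lim_G: "x \<in> interior (\<Union>i\<in>I. C i) - E \<Longrightarrow>
      \<exists>L. \<forall>i\<in>I. x \<in> C i \<longrightarrow> (G \<longlongrightarrow> L) (at x within interior (C i))"
    and dim: "2 \<le> DIM('a)"
begin

section \<open>Continuity and differentiability in the interior of the union\<close>

definition D where "D = (\<Union>i\<in>I. C i)"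

text \<open>By \<open>closed_C\<close>, a piece that does not contain \<open>x\<close> misses a
  neighbourhood of \<open>x\<close>; finitely many such neighbourhoods are intersected.\<close>

lemma eventually_active:
  assumes "x \<in> interior D"
  shows "\<forall>\<^sub>F y in nhds x. \<forall>i\<in>I. y \<in> C i \<longrightarrow> x \<in> C i"
proof (intro eventually_ball_finite finite_I ballI)
  fix i assume "i \<in> I"
  show "\<forall>\<^sub>F y in nhds x. y \<in> C i \<longrightarrow> x \<in> C i"
  proof (cases "x \<in> C i")
    case False
    then have "x \<in> - closure (C i)"
      using closed_C[OF \<open>i \<in> I\<close>] assms by (auto simp: D_def)
    then have "\<forall>\<^sub>F y in nhds x. y \<in> - closure (C i)"
      by (intro eventually_nhds_in_open) auto
    then show ?thesis
      by eventually_elim (use closure_subset in blast)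
  qed simp
qed

lemma isCont_interior:
  assumes "x \<in> interior D"
  shows "isCont g x"
proof -
  have "(g \<longlongrightarrow> g x) (at x within D)"
    unfolding D_def
  proof (rule Lim_within_UN[OF finite_I])
    fix i assume "i \<in> I"
    show "(g \<longlongrightarrow> g x) (at x within C i)"
    proof (cases "x \<in> C i")
      case True
      then show ?thesis
        using cont_C[OF \<open>i \<in> I\<close>] by (auto simp: continuous_on_def)
    next
      case False
      then have "x \<notin> closure (C i)"
        using closed_C[OF \<open>i \<in> I\<close>] assms by (auto simp: D_def)
      then show ?thesis
        by (simp add: not_in_closure_trivial_limitI)
    qed
  qed
  then show ?thesis
    using assms by (simp add: isCont_def at_within_interior[of x D])
qed

text \<open>The common limit supplied by \<open>lim_G\<close>. It is meaningful on
  \<open>interior D - E\<close>; elsewhere the choice may be arbitrary.\<close>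

definition grad where
  "grad x = (SOME L. \<forall>i\<in>I. x \<in> C i \<longrightarrow> (G \<longlongrightarrow> L) (at x within interior (C i)))"

lemma tendsto_grad:
  assumes "x \<in> interior D - E" and "i \<in> I" and "x \<in> C i"
  shows "(G \<longlongrightarrow> grad x) (at x within interior (C i))"
  using someI_ex[OF lim_G[of x]] assms unfolding grad_def D_def by blast

text \<open>All pieces containing \<open>x\<close> yield the same derivative within themselves, and
  the others impose no condition, so the derivatives combine over the finite union, which is a
  neighbourhood of \<open>x\<close>.\<close>

lemma GDERIV_grad:
  assumes x: "x \<in> interior D - E"
  shows "GDERIV g x :> grad x"
proof -
  have "(g has_derivative (\<lambda>h. inner h (grad x))) (at x within D)"
    unfolding D_def
  proof (rule has_derivative_within_UN[OF finite_I])
    show "I \<noteq> {}"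
      using x interior_subset[of D] by (auto simp: D_def)
    fix i assume i: "i \<in> I"
    show "(g has_derivative (\<lambda>h. inner h (grad x))) (at x within C i)"
    proof (cases "x \<in> C i")
      case True
      show ?thesis
        using has_derivative_within_gradient_limit
            [OF convex_C[OF i] interior_C[OF i] cont_C[OF i] True deriv_C[OF i] tendsto_grad[OF x i True]] .
    next
      case False
      then have "x \<notin> closure (C i)"
        using closed_C[OF i] x by (auto simp: D_def)
      then show ?thesis
        by (intro has_derivative_within_not_closure bounded_linear_inner_left)
    qed
  qed
  then show ?thesis
    using x by (simp add: gderiv_def at_within_interior[of x D])
qed

text \<open>Within one piece, \<open>grad y\<close> is itself a limit of values of \<open>G\<close>
  from the interior, and near \<open>x\<close> these values are already close to
  \<open>grad x\<close>.\<close>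

lemma continuous_on_grad: "continuous_on (interior D - E) grad"
  unfolding continuous_on_def
proof
  fix x assume x: "x \<in> interior D - E"
  have "(grad \<longlongrightarrow> grad x) (at x within (\<Union>i\<in>I. C i \<inter> (interior D - E)))"
  proof (rule Lim_within_UN[OF finite_I])
    fix i assume i: "i \<in> I"
    show "(grad \<longlongrightarrow> grad x) (at x within C i \<inter> (interior D - E))"
    proof (cases "x \<in> C i")
      case False
      then have "x \<notin> closure (C i)"
        using closed_C[OF i] x by (auto simp: D_def)
      then have "x \<notin> closure (C i \<inter> (interior D - E))"
        using closure_mono[of "C i \<inter> (interior D - E)" "C i"] by auto
      then show ?thesis
        by (simp add: not_in_closure_trivial_limitI)
    next
      case True
      have "\<exists>d>0. \<forall>y\<in>C i \<inter> (interior D - E). y \<noteq> x \<and> dist y x < d \<longrightarrow> dist (grad y) (grad x) < e"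
        if "e > 0" for e
      proof -
        have "\<forall>\<^sub>F z in at x within interior (C i). dist (G z) (grad x) < e / 2"
          using tendstoD[OF tendsto_grad[OF x i True], of "e / 2"] \<open>e > 0\<close> by simp
        then obtain d where "d > 0"
          and d: "\<And>z. z \<in> interior (C i) \<Longrightarrow> z \<noteq> x \<Longrightarrow> dist z x < d \<Longrightarrow> dist (G z) (grad x) < e / 2"
          by (auto simp: eventually_at)
        have "dist (grad y) (grad x) < e" if y: "y \<in> C i" "y \<in> interior D - E" "y \<noteq> x" "dist y x < d" for y
        proof -
          \<comment> \<open>Passing to the limit \<open>z\<close> to \<open>y\<close> only preserves
            the weak bound \<open>e / 2\<close>, which is why half of \<open>e\<close> was
            used.\<close>
          have "((\<lambda>z. dist (G z) (grad x)) \<longlongrightarrow> dist (grad y) (grad x)) (at y within interior (C i))"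
            using y i by (intro tendsto_intros tendsto_grad)
          moreover have "\<forall>\<^sub>F z in at y within interior (C i). dist (G z) (grad x) \<le> e / 2"
          proof -
            have "\<forall>\<^sub>F z in at y within interior (C i). z \<in> ball x d - {x}"
              using y eventually_nhds_in_open[of "ball x d - {x}" y]
              by (auto simp: dist_commute open_delete eventually_at_filter elim: eventually_mono)
            moreover have "\<forall>\<^sub>F z in at y within interior (C i). z \<in> interior (C i)"
              by (auto simp: eventually_at_filter)
            ultimately show ?thesis
              by eventually_elim (use d in \<open>auto simp: dist_commute intro: less_imp_le\<close>)
          qed
          moreover have "at y within interior (C i) \<noteq> bot"
            using y i by (intro at_within_interior_neq_bot convex_C interior_C)
          ultimately have "dist (grad y) (grad x) \<le> e / 2"
            by (rule tendsto_upperbound)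
          then show ?thesis
            using \<open>e > 0\<close> by simp
        qed
        then show ?thesis
          using \<open>d > 0\<close> by blast
      qed
      then show ?thesis
        by (auto simp: tendsto_iff eventually_at)
    qed
  qed
  moreover have "(\<Union>i\<in>I. C i \<inter> (interior D - E)) = interior D - E"
    using interior_subset[of D] by (auto simp: D_def)
  ultimately show "(grad \<longlongrightarrow> grad x) (at x within interior D - E)"
    by simp
qed

section \<open>Monotonicity of the gradient and convexity on the interior\<close>

text \<open>The sum of the two gradient inequalities of the convex function at \<open>x\<close> and
  at \<open>y\<close>.\<close>

lemma grad_mono:
  assumes "x \<in> interior D - E" and "y \<in> interior D - E" and "i \<in> I" and "x \<in> C i" and "y \<in> C i"
  shows "inner (y - x) (grad x) \<le> inner (y - x) (grad y)"
proof -
  have "inner (y - x) (grad x) \<le> g y - g x" "inner (x - y) (grad y) \<le> g x - g y"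
    using has_derivative_le_increment[of g _ _ "C i"] GDERIV_grad convex_on_C assms
    unfolding gderiv_def by blast+
  then show ?thesis
    by (simp add: inner_diff_left)
qed

text \<open>Near a parameter \<open>u\<close>, any piece containing \<open>?p v\<close> also
  contains \<open>?p u\<close>, so \<open>grad_mono\<close> compares the two points; local
  monotonicity then gives the global one.\<close>

lemma grad_mono_segment:
  assumes seg: "closed_segment x y \<subseteq> interior D - E" and "0 \<le> s" and "s \<le> t" and "t \<le> 1"
  shows "inner (y - x) (grad (x + s *\<^sub>R (y - x))) \<le> inner (y - x) (grad (x + t *\<^sub>R (y - x)))"
  using \<open>s \<le> t\<close>
proof (rule locally_mono_imp_le)
  let ?p = "\<lambda>u. x + u *\<^sub>R (y - x)"
  fix u assume u: "s \<le> u" "u \<le> t"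
  have seg: "?p v \<in> interior D - E" if "v \<in> {s..t}" for v
    using seg assms that add_scaleR_diff_in_closed_segment[of v x y] by auto
  then have "?p u \<in> interior D"
    using u by auto
  moreover have "filterlim ?p (nhds (?p u)) (nhds u)"
    by (intro tendsto_intros filterlim_ident)
  ultimately have "\<forall>\<^sub>F v in nhds u. \<forall>i\<in>I. ?p v \<in> C i \<longrightarrow> ?p u \<in> C i"
    using eventually_active[of "?p u"] by (auto simp: filterlim_iff)
  then obtain d where "d > 0" and d: "\<And>v i. \<bar>v - u\<bar> < d \<Longrightarrow> i \<in> I \<Longrightarrow> ?p v \<in> C i \<Longrightarrow> ?p u \<in> C i"
    by (auto simp: eventually_nhds_metric dist_real_def)
  have "(v \<le> u \<longrightarrow> inner (y - x) (grad (?p v)) \<le> inner (y - x) (grad (?p u))) \<and>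
        (u \<le> v \<longrightarrow> inner (y - x) (grad (?p u)) \<le> inner (y - x) (grad (?p v)))"
    if v: "v \<in> {s..t}" "\<bar>v - u\<bar> < d" for v
  proof -
    obtain i where i: "i \<in> I" "?p v \<in> C i"
      using seg[OF v(1)] interior_subset[of D] by (auto simp: D_def)
    then have "inner (?p u - ?p v) (grad (?p v)) \<le> inner (?p u - ?p v) (grad (?p u))"
      using seg v u d by (intro grad_mono) auto
    moreover have "?p u - ?p v = (u - v) *\<^sub>R (y - x)"
      by (simp add: algebra_simps)
    ultimately have "(u - v) * inner (y - x) (grad (?p v)) \<le> (u - v) * inner (y - x) (grad (?p u))"
      by (metis inner_scaleR_left)
    then show ?thesis
      \<comment> \<open>The sign of \<open>u - v\<close> decides which of the two inequalities
        results after cancelling it.\<close>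
      by (cases u v rule: linorder_cases) auto
  qed
  then show "\<exists>d>0. \<forall>v\<in>{s..t}. \<bar>v - u\<bar> < d \<longrightarrow>
      (v \<le> u \<longrightarrow> inner (y - x) (grad (?p v)) \<le> inner (y - x) (grad (?p u))) \<and>
      (u \<le> v \<longrightarrow> inner (y - x) (grad (?p u)) \<le> inner (y - x) (grad (?p v)))"
    using \<open>d > 0\<close> by blast
qed

text \<open>Along the segment, \<open>g\<close> has the directional derivative
  \<open>inner (y - x) (grad ...)\<close>, which is increasing.\<close>

lemma convex_ineq_segment:
  assumes "closed_segment x y \<subseteq> interior D - E" and "0 \<le> t" and "t \<le> 1"
  shows "g ((1 - t) *\<^sub>R x + t *\<^sub>R y) \<le> (1 - t) * g x + t * g y"
proof -
  let ?h = "\<lambda>t. g (x + t *\<^sub>R (y - x))"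
  have "convex_on {0..1} ?h"
  proof (rule convex_on_realI)
    show "connected {0..1::real}"
      by simp
    fix s :: real assume s: "s \<in> {0..1}"
    then have "x + s *\<^sub>R (y - x) \<in> interior D - E"
      using assms(1) add_scaleR_diff_in_closed_segment[of s x y] by auto
    then have "(g has_derivative (\<lambda>h. inner h (grad (x + s *\<^sub>R (y - x))))) (at (x + s *\<^sub>R (y - x)))"
      using GDERIV_grad by (simp add: gderiv_def)
    moreover have "((\<lambda>s. x + s *\<^sub>R (y - x)) has_derivative (\<lambda>s. s *\<^sub>R (y - x))) (at s)"
      by (auto intro!: derivative_eq_intros)
    ultimately have "(?h has_derivative (\<lambda>t. inner (t *\<^sub>R (y - x)) (grad (x + s *\<^sub>R (y - x))))) (at s)"
      by (rule has_derivative_compose[rotated])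
    then show "(?h has_real_derivative inner (y - x) (grad (x + s *\<^sub>R (y - x)))) (at s)"
      by (simp add: has_field_derivative_def mult_commute_abs)
  qed (use grad_mono_segment[OF assms(1)] in auto)
  from convex_onD[OF this, of t 0 1] show ?thesis
    using assms by (simp add: algebra_simps)
qed

lemma convex_on_interior: "convex_on (interior D) g"
proof -
  have convex_int: "convex (interior D)"
    using convex_D by (simp add: D_def convex_interior)
  show ?thesis
  proof (rule convex_onI)
    fix t :: real and x y
    assume t: "0 < t" "t < 1" and xy: "x \<in> interior D" "y \<in> interior D"
    obtain w where w: "w \<noteq> 0" "orthogonal (y - x) w"
      using orthogonal_to_vector_exists[OF dim] .
    have lim: "((\<lambda>r. z + r *\<^sub>R w) \<longlongrightarrow> z) (at 0)" for z
      by (auto intro!: tendsto_eq_intros)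
    have limg: "((\<lambda>r. g (z + r *\<^sub>R w)) \<longlongrightarrow> g z) (at 0)" if "z \<in> interior D" for z
      by (rule isCont_tendsto_compose[OF isCont_interior[OF that] lim])
    have "\<forall>\<^sub>F r in at 0. z + r *\<^sub>R w \<in> interior D" if "z \<in> interior D" for z
      using topological_tendstoD[OF lim open_interior that] .
    then have "\<forall>\<^sub>F r in at 0. x + r *\<^sub>R w \<in> interior D" "\<forall>\<^sub>F r in at 0. y + r *\<^sub>R w \<in> interior D"
      using xy by auto
    \<comment> \<open>As \<open>w\<close> is orthogonal to the segment, each point of \<open>E\<close> lies on at most one of its shifts.\<close>
    moreover have "\<forall>\<^sub>F r in at 0. r \<notin> (\<lambda>e. inner (e - x) w / inner w w) ` E"
    proof -
      let ?B = "(\<lambda>e. inner (e - x) w / inner w w) ` E"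
      \<comment> \<open>The unshifted segment may meet \<open>E\<close>, so 0 may belong to
        \<open>?B\<close>. It is removed to get an open neighbourhood of 0, and the filter
        \<open>at 0\<close> ignores it anyway.\<close>
      have "\<forall>\<^sub>F r in nhds 0. r \<in> - (?B - {0})"
        using finite_imp_closed[of "?B - {0}"] finite_E by (intro eventually_nhds_in_open open_Compl) auto
      then show ?thesis
        by (auto simp: eventually_at_filter elim: eventually_mono)
    qed
    ultimately have "\<forall>\<^sub>F r in at 0. g ((1 - t) *\<^sub>R (x + r *\<^sub>R w) + t *\<^sub>R (y + r *\<^sub>R w)) \<le>
        (1 - t) * g (x + r *\<^sub>R w) + t * g (y + r *\<^sub>R w)"
    proof eventually_elim
      case (elim r)
      have "e \<notin> E" if e: "e \<in> closed_segment (x + r *\<^sub>R w) (y + r *\<^sub>R w)" for e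
      proof
        assume "e \<in> E"
        obtain u where "e = (1 - u) *\<^sub>R (x + r *\<^sub>R w) + u *\<^sub>R (y + r *\<^sub>R w)"
          using e by (auto simp: closed_segment_def)
        then have "e - x = u *\<^sub>R (y - x) + r *\<^sub>R w"
          by (simp add: algebra_simps)
        then have "inner (e - x) w = r * inner w w"
          using w by (simp add: orthogonal_def inner_add_left)
        then have "r = inner (e - x) w / inner w w"
          using w by simp
        then show False
          using elim \<open>e \<in> E\<close> by blast
      qed
      then have "closed_segment (x + r *\<^sub>R w) (y + r *\<^sub>R w) \<subseteq> interior D - E"
        using closed_segment_subset[OF elim(1,2) convex_int] by blast
      then show ?case
        using t by (intro convex_ineq_segment) auto
    qed
    moreover have "(1 - t) *\<^sub>R (x + r *\<^sub>R w) + t *\<^sub>R (y + r *\<^sub>R w) = ((1 - t) *\<^sub>R x + t *\<^sub>R y) + r *\<^sub>R w" for r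
      by (simp add: algebra_simps)
    ultimately have "\<forall>\<^sub>F r in at 0. g (((1 - t) *\<^sub>R x + t *\<^sub>R y) + r *\<^sub>R w) \<le>
        (1 - t) * g (x + r *\<^sub>R w) + t * g (y + r *\<^sub>R w)"
      by simp
    moreover have "(1 - t) *\<^sub>R x + t *\<^sub>R y \<in> interior D"
      using convexD[OF convex_int xy, of "1 - t" t] t by simp
    moreover have "((\<lambda>r. (1 - t) * g (x + r *\<^sub>R w) + t * g (y + r *\<^sub>R w))
        \<longlongrightarrow> (1 - t) * g x + t * g y) (at 0)"
      using xy by (intro tendsto_add tendsto_mult_left limg)
    ultimately show "g ((1 - t) *\<^sub>R x + t *\<^sub>R y) \<le> (1 - t) * g x + t * g y"
      using tendsto_le[OF trivial_limit_at _ limg] by blast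
  qed (fact convex_int)
qed

section \<open>Extending convexity from the interior to the whole union\<close>

lemma interior_C_subset: "i \<in> I \<Longrightarrow> interior (C i) \<subseteq> interior D"
  unfolding D_def by (intro interior_mono) blast

text \<open>
  The pieces need not be relatively closed in \<open>D\<close> at its boundary, so \<open>g\<close> is not known to be continuous
  at \<open>x\<close> along \<open>D\<close>, and \<open>x\<close> has to be approached within a single piece.
\<close>

lemma convex_ineq_ray:
  assumes "x \<in> D" and c: "c \<in> interior D" and s: "0 < s" "s < 1"
  shows "g (x + s *\<^sub>R (c - x)) \<le> (1 - s) * g x + s * g c"
proof -
  obtain i b where i: "i \<in> I" "x \<in> C i" and b: "b \<in> interior (C i)"
    using assms(1) interior_C unfolding D_def by blast
  let ?x = "\<lambda>r. x + r *\<^sub>R (b - x)"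
  have "x + s *\<^sub>R (c - x) \<in> interior D"
    using mem_interior_closure_convex_shrink[of D c x s] assms convex_D closure_subset[of D]
    by (auto simp: D_def algebra_simps)
  then have "isCont g (x + s *\<^sub>R (c - x))"
    by (rule isCont_interior)
  moreover have "((\<lambda>r. ?x r + s *\<^sub>R (c - ?x r)) \<longlongrightarrow> x + s *\<^sub>R (c - x)) (at_right 0)"
    by (intro tendsto_intros tendsto_radial)
  ultimately have "((\<lambda>r. g (?x r + s *\<^sub>R (c - ?x r))) \<longlongrightarrow> g (x + s *\<^sub>R (c - x))) (at_right 0)"
    by (rule isCont_tendsto_compose)
  moreover have "((\<lambda>r. (1 - s) * g (?x r) + s * g c) \<longlongrightarrow> (1 - s) * g x + s * g c) (at_right 0)"
    using i b by (intro tendsto_intros tendsto_radial_continuous_on[OF convex_C _ _ cont_C]) auto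
  moreover have "\<forall>\<^sub>F r in at_right 0. g (?x r + s *\<^sub>R (c - ?x r)) \<le> (1 - s) * g (?x r) + s * g c"
    using eventually_radial_interior[OF convex_C[OF i(1)] b i(2)]
  proof eventually_elim
    case (elim r)
    have "g ((1 - s) *\<^sub>R ?x r + s *\<^sub>R c) \<le> (1 - s) * g (?x r) + s * g c"
      using elim interior_C_subset[OF i(1)] c s by (intro convex_onD[OF convex_on_interior]) auto
    then show ?case
      by (simp add: algebra_simps)
  qed
  ultimately show ?thesis
    by (intro tendsto_le[of "at_right 0"]) auto
qed

text \<open>All three points are shrunk towards \<open>c\<close> by the factor \<open>1 - s\<close>.
  This moves them into \<open>interior D\<close>, where \<open>g\<close> is convex;
  \<open>convex_ineq_ray\<close> bounds the shrunk endpoints, and \<open>s\<close> tends to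
  0.\<close>

theorem convex_on_D: "convex_on D g"
proof (rule convex_onI)
  show "convex D"
    using convex_D by (simp add: D_def)
  fix t :: real and x y
  assume t: "0 < t" "t < 1" and xy: "x \<in> D" "y \<in> D"
  let ?z = "(1 - t) *\<^sub>R x + t *\<^sub>R y"
  have "?z \<in> D"
    using convexD[OF \<open>convex D\<close> xy, of "1 - t" t] t by simp
  \<comment> \<open>The centre is taken in a piece containing \<open>?z\<close>, so that
    \<open>g\<close> is continuous at \<open>?z\<close> along the ray towards
    \<open>c\<close>.\<close>
  then obtain k c where k: "k \<in> I" "?z \<in> C k" and c: "c \<in> interior (C k)"
    using interior_C unfolding D_def by blast
  have cD: "c \<in> interior D"
    using c k interior_C_subset by auto
  let ?r = "\<lambda>s u. u + s *\<^sub>R (c - u)"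
  have "((\<lambda>s. g (?r s ?z)) \<longlongrightarrow> g ?z) (at_right 0)"
    using k c by (intro tendsto_radial_continuous_on[OF convex_C _ _ cont_C]) auto
  moreover have "((\<lambda>s. (1 - t) * ((1 - s) * g x + s * g c) + t * ((1 - s) * g y + s * g c))
      \<longlongrightarrow> (1 - t) * g x + t * g y) (at_right 0)"
    by (auto intro!: tendsto_eq_intros)
  moreover have "\<forall>\<^sub>F s in at_right 0. g (?r s ?z) \<le>
      (1 - t) * ((1 - s) * g x + s * g c) + t * ((1 - s) * g y + s * g c)"
  proof -
    have "g (?r s ?z) \<le> (1 - t) * ((1 - s) * g x + s * g c) + t * ((1 - s) * g y + s * g c)"
      if s: "0 < s" "s < 1" for s
    proof -
      have "?r s u \<in> interior D" if "u \<in> D" for u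
        using mem_interior_closure_convex_shrink[OF \<open>convex D\<close> cD, of u s] that s closure_subset[of D]
        by (auto simp: algebra_simps)
      then have "g ((1 - t) *\<^sub>R ?r s x + t *\<^sub>R ?r s y) \<le> (1 - t) * g (?r s x) + t * g (?r s y)"
        using xy t by (intro convex_onD[OF convex_on_interior]) auto
      also have "\<dots> \<le> (1 - t) * ((1 - s) * g x + s * g c) + t * ((1 - s) * g y + s * g c)"
        using xy t s cD by (intro add_mono mult_left_mono convex_ineq_ray) auto
      also have "(1 - t) *\<^sub>R ?r s x + t *\<^sub>R ?r s y = ?r s ?z"
        by (simp add: algebra_simps)
      finally show ?thesis .
    qed
    then show ?thesis
      unfolding eventually_at_right_field by (intro exI[of _ 1]) auto
  qed
  ultimately show "g ?z \<le> (1 - t) * g x + t * g y"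
    by (intro tendsto_le[of "at_right 0"]) auto
qed

end

section \<open>Extended-real functions: the minimum and convexity\<close>

lemma min_fun_neq_MInf:
  assumes "finite I" and "I \<noteq> {}" and "\<And>i. i \<in> I \<Longrightarrow> proper_fun (f i)"
  shows "min_fun I f x \<noteq> -\<infinity>"
proof -
  have "min_fun I f x \<in> (\<lambda>i. f i x) ` I"
    unfolding min_fun_def using assms(1,2) by (intro Min_in) auto
  then obtain i where "i \<in> I" "min_fun I f x = f i x"
    by blast
  then show ?thesis
    using assms(3)[of i] by (simp add: proper_fun_def)
qed

text \<open>Every other function either agrees with \<open>f i\<close> at \<open>x\<close> or is
  infinite there.\<close>

lemma min_fun_eq:
  assumes "finite I" and "compatible_funs I f" and "i \<in> I" and "x \<in> dom_of (f i)"
  shows "min_fun I f x = f i x"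
  unfolding min_fun_def
proof (rule Min_eqI)
  fix y assume "y \<in> (\<lambda>j. f j x) ` I"
  then obtain j where j: "j \<in> I" "y = f j x"
    by blast
  show "f i x \<le> y"
  proof (cases "x \<in> dom_of (f j)")
    case True
    then show ?thesis
      using assms j unfolding compatible_funs_def by (metis IntI order_refl)
  next
    case False
    then show ?thesis
      using j by (auto simp: dom_of_def)
  qed
qed (use assms in auto)

text \<open>Off the domain the right-hand side of the inequality is infinite: both weights are
  positive and the value of minus infinity is excluded.\<close>

lemma convex_fun_iff_convex_on:
  assumes "\<And>x. g x \<noteq> -\<infinity>" and "convex (dom_of g)"
  shows "convex_fun g \<longleftrightarrow> convex_on (dom_of g) (\<lambda>x. real_of_ereal (g x))"
proof -
  have fin: "g x = ereal (real_of_ereal (g x))" if "x \<in> dom_of g" for x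
    using that assms(1)[of x] by (cases "g x") (auto simp: dom_of_def)
  have inf: "g x = \<infinity>" if "x \<notin> dom_of g" for x
    using that by (auto simp: dom_of_def)
  have real_ineq: "g ((1 - t) *\<^sub>R x + t *\<^sub>R y) \<le> ereal (1 - t) * g x + ereal t * g y \<longleftrightarrow>
      real_of_ereal (g ((1 - t) *\<^sub>R x + t *\<^sub>R y)) \<le>
        (1 - t) * real_of_ereal (g x) + t * real_of_ereal (g y)"
    if "x \<in> dom_of g" "y \<in> dom_of g" "0 < t" "t < 1" for x y t
  proof -
    have "(1 - t) *\<^sub>R x + t *\<^sub>R y \<in> dom_of g"
      using convexD[OF assms(2) that(1,2), of "1 - t" t] that by simp
    from fin[OF this] fin[OF that(1)] fin[OF that(2)] show ?thesis
      by (metis ereal_less_eq(3) plus_ereal.simps(1) times_ereal.simps(1))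
  qed
  show ?thesis
  proof
    assume "convex_fun g"
    then show "convex_on (dom_of g) (\<lambda>x. real_of_ereal (g x))"
      using real_ineq assms(2) by (intro convex_onI) (auto simp: convex_fun_def)
  next
    assume cvx: "convex_on (dom_of g) (\<lambda>x. real_of_ereal (g x))"
    show "convex_fun g"
      unfolding convex_fun_def
    proof (intro allI ballI)
      fix x y and t :: real
      assume t: "t \<in> {0<..<1}"
      show "g ((1 - t) *\<^sub>R x + t *\<^sub>R y) \<le> ereal (1 - t) * g x + ereal t * g y"
      proof (cases "x \<in> dom_of g \<and> y \<in> dom_of g")
        case True
        then show ?thesis
          using real_ineq[of x y t] convex_onD[OF cvx, of t x y] t by auto
      next
        case False
        then have "ereal (1 - t) * g x + ereal t * g y = \<infinity>"
          using inf[of x] inf[of y] assms(1)[of x] assms(1)[of y] t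
          by (cases "g x"; cases "g y") auto
        then show ?thesis
          by (simp only: ereal_less_eq(1))
      qed
    qed
  qed
qed

section \<open>Reduction to the real-valued glued function\<close>

theorem theorem5p4:
  fixes I :: "'i set"
    and f :: "'i \<Rightarrow> 'a::euclidean_space \<Rightarrow> ereal"
    and E :: "'a set"
  assumes "finite I" and "I \<noteq> {}"
    and "\<And>i. i \<in> I \<Longrightarrow> proper_fun (f i)"
    and "\<And>i. i \<in> I \<Longrightarrow> convex_fun (f i)"
    and "compatible_funs I f"
    and "\<And>i. i \<in> I \<Longrightarrow> interior (dom_of (f i)) \<noteq> {}"
    and "\<And>i. i \<in> I \<Longrightarrow> differentiable_fun_on (f i) (interior (dom_of (f i)))"
    and "convex (dom_of (min_fun I f))"
    and "aff_dim (dom_of (min_fun I f)) \<ge> 2"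
    and "compatible_sets I (\<lambda>i. dom_of (f i))"
    and "finite E"
    and "\<And>x i j. \<lbrakk>x \<in> interior (dom_of (min_fun I f)) - E; i \<in> active I f x; j \<in> active I f x\<rbrakk> \<Longrightarrow>
           \<exists>L. (gradient (f i) \<longlongrightarrow> L) (at x within interior (dom_of (f i))) \<and>
               (gradient (f j) \<longlongrightarrow> L) (at x within interior (dom_of (f j)))"
  shows "convex_fun (min_fun I f) \<and>
         continuously_differentiable_fun_on (min_fun I f) (interior (dom_of (min_fun I f)) - E)"
proof -
  let ?F = "min_fun I f" and ?C = "\<lambda>i. dom_of (f i)"
  let ?g = "\<lambda>x. real_of_ereal (?F x)"
  have domF: "dom_of ?F = (\<Union>i\<in>I. ?C i)"
    using assms(1,2) by (rule dom_of_min_fun)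
  have F_eq: "?F x = f i x" if "i \<in> I" "x \<in> ?C i" for i x
    using min_fun_eq assms(1,5) that .
  have convex_C: "convex (?C i)" if "i \<in> I" for i
    using assms(10) that by (simp add: compatible_sets_def)
  have interior_C: "interior (?C i) \<subseteq> interior (dom_of ?F)" if "i \<in> I" for i
    unfolding domF using that by (intro interior_mono) blast
  have grad_eq: "has_gradient ?F z (gradient (f i) z)" if i: "i \<in> I" and z: "z \<in> interior (?C i)" for i z
  proof -
    obtain v where v: "has_gradient (f i) z v"
      using assms(7)[OF i] z by (auto simp: differentiable_fun_on_def)
    then have "((\<lambda>y. real_of_ereal (f i y)) has_derivative (\<lambda>h. inner h v)) (at z)"
      by (simp add: has_gradient_def gderiv_def)
    then have "(?g has_derivative (\<lambda>h. inner h v)) (at z)"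
    proof (rule has_derivative_transform_within_open[OF _ open_interior z])
      show "real_of_ereal (f i y) = ?g y" if "y \<in> interior (?C i)" for y
        using F_eq[OF i] that interior_subset by fastforce
    qed
    then show ?thesis
      using interior_C[OF i] z has_gradient_imp_gradient_eq[OF v]
      by (auto simp: has_gradient_def gderiv_def)
  qed
  \<comment> \<open>\<open>gradient ?F\<close> can serve as \<open>G\<close>, because by
    \<open>grad_eq\<close> it agrees with \<open>gradient (f i)\<close> on the interior of each
    domain.\<close>
  interpret glued_convex I ?C ?g "gradient ?F" E
  proof
    show "finite I" "finite E"
      by fact+
    show "convex (\<Union>i\<in>I. ?C i)"
      using assms(8) domF by simp
    show "2 \<le> DIM('a)"
      using assms(9) aff_dim_le_DIM[of "dom_of ?F"] by linarith
    fix i assume i: "i \<in> I"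
    have F_fin: "\<bar>f i x\<bar> \<noteq> \<infinity>" if "x \<in> ?C i" for x
      using that assms(3)[OF i] by (auto simp: proper_fun_def dom_of_def)
    show "convex (?C i)"
      using i by (rule convex_C)
    show "interior (?C i) \<noteq> {}"
      using i by (rule assms(6))
    have "continuous_on (?C i) (real_of_ereal \<circ> f i)"
      using assms(5) i by (subst continuous_on_iff_real[symmetric]) (auto simp: compatible_funs_def F_fin)
    then show "continuous_on (?C i) ?g"
      by (rule continuous_on_cong[THEN iffD1, rotated 2]) (auto simp: F_eq[OF i])
    have "convex_on (?C i) (\<lambda>x. real_of_ereal (f i x))"
      using assms(3,4)[OF i] convex_C[OF i] convex_fun_iff_convex_on by (auto simp: proper_fun_def)
    then show "convex_on (?C i) ?g"
      unfolding convex_on_def by (simp add: F_eq[OF i] convexD[OF convex_C[OF i]])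
    show "GDERIV ?g z :> gradient ?F z" if "z \<in> interior (?C i)" for z
      using grad_eq[OF i that] has_gradient_imp_gradient_eq[OF grad_eq[OF i that]]
      by (simp add: has_gradient_def)
    fix x assume x: "x \<in> interior (\<Union>i\<in>I. ?C i)" "x \<in> closure (?C i)"
    obtain k where k: "k \<in> I" "x \<in> ?C k"
      using x(1) interior_subset by blast
    \<comment> \<open>Compatibility concerns pairs of sets, so \<open>?C i\<close> is paired with a
      piece \<open>?C k\<close> that contains \<open>x\<close>; the relative interior is the
      interior because the latter contains \<open>x\<close>.\<close>
    show "x \<in> ?C i"
    proof (cases "i = k")
      case False
      have "rel_interior (\<Union>i\<in>I. ?C i) = interior (\<Union>i\<in>I. ?C i)"
        using x by (intro rel_interior_nonempty_interior) auto
      then have "x \<in> closure (?C i) \<inter> closure (?C k) \<inter> rel_interior (\<Union>i\<in>I. ?C i)"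
        using x k closure_subset by auto
      then show ?thesis
        using assms(10) i k False unfolding compatible_sets_def by blast
    qed (use k in simp)
  next
    fix x assume x: "x \<in> interior (\<Union>i\<in>I. ?C i) - E"
    obtain k where k: "k \<in> I" "x \<in> ?C k"
      using x interior_subset by blast
    have x': "x \<in> interior (dom_of ?F) - E"
      using x domF by simp
    have act: "i \<in> active I f x" if "i \<in> I" "x \<in> ?C i" for i
      using that by (simp add: active_def)
    \<comment> \<open>The limits are assumed equal only in pairs. A fixed active \<open>k\<close>
      and uniqueness of its limit give one \<open>L\<close> for all active indices.\<close>
    obtain L where L: "(gradient (f k) \<longlongrightarrow> L) (at x within interior (?C k))"
      using assms(12)[OF x' act[OF k] act[OF k]] by blast
    have "(gradient ?F \<longlongrightarrow> L) (at x within interior (?C i))" if i: "i \<in> I" "x \<in> ?C i" for i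
    proof -
      obtain M where lim: "(gradient (f i) \<longlongrightarrow> M) (at x within interior (?C i))"
        and M: "(gradient (f k) \<longlongrightarrow> M) (at x within interior (?C k))"
        using assms(12)[OF x' act[OF i] act[OF k]] by blast
      have "M = L"
        using at_within_interior_neq_bot[OF convex_C[OF k(1)] assms(6)[OF k(1)] k(2)] M L
        by (rule tendsto_unique)
      moreover have "\<forall>\<^sub>F z in at x within interior (?C i). gradient (f i) z = gradient ?F z"
        using has_gradient_imp_gradient_eq[OF grad_eq[OF i(1)]] by (auto simp: eventually_at_filter)
      ultimately show ?thesis
        using Lim_transform_eventually[OF lim] by simp
    qed
    then show "\<exists>L. \<forall>i\<in>I. x \<in> ?C i \<longrightarrow> (gradient ?F \<longlongrightarrow> L) (at x within interior (?C i))"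
      by blast
  qed
  have D: "D = dom_of ?F"
    using domF by (simp add: D_def)
  have "convex_fun ?F"
    using convex_on_D assms(8) D
    by (subst convex_fun_iff_convex_on) (auto simp: min_fun_neq_MInf[OF assms(1-3)])
  \<comment> \<open>Only now is \<open>gradient ?F\<close> identified with \<open>grad\<close> also
    where pieces meet, so that the continuity of \<open>grad\<close> carries over.\<close>
  moreover have "has_gradient ?F x (grad x)" if "x \<in> interior (dom_of ?F) - E" for x
    using GDERIV_grad[of x] that D by (simp add: has_gradient_def)
  then have "differentiable_fun_on ?F (interior (dom_of ?F) - E)"
    and "\<And>x. x \<in> interior (dom_of ?F) - E \<Longrightarrow> gradient ?F x = grad x"
    using has_gradient_imp_gradient_eq unfolding differentiable_fun_on_def by blast+
  moreover from this(2) have "continuous_on (interior (dom_of ?F) - E) (gradient ?F)"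
    using continuous_on_grad continuous_on_cong[OF refl, of _ "gradient ?F" grad] D by metis
  ultimately show ?thesis
    by (simp add: continuously_differentiable_fun_on_def)
qed

end
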